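(* Let $\mathcal S=\{A_1,\dots,A_l\}$ be a set of stochastic matrices of the same order and let $\mathbf w=(w_1,\dots,w_l)\in\mathbb R^l$ be a vector with $w_i>0$ for all $i$ and $\sum_{i=1}^l w_i=1$. Let $X^1,X^2,\dots$ be i.i.d. random matrices with $\Pr(X^t=A_i)=w_i$. Then the product $\prod_{t=1}^{n}X^t$ converges, as $n\to\infty$, to a rank one matrix with probability one if and only if there exists a finite product $B=\prod_{i=1}^{N}B_i$ of matrices, with each $B_i\in\mathcal S$, such that $B$ is scrambling.
   Context: Stochastic means row stochastic: nonnegative entries with every row summing to $1$. Product convention: $\prod_{t=1}^{n}A_t=A_nA_{n-1}\cdots A_1$. For a square stochastic matrix $P=(p_{ij})$, the ergodic coefficient is $\gamma(P)=\min_{\{i_1,i_2\}}\sum_j\min(p_{i_1j},p_{i_2j})$, the minimum being over pairs of rows, and $\lambda(P)=1-\gamma(P)$. The matrix $P$ is called scrambling if $\lambda(P)<1$. *)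

theory Defs
  imports "HOL-Probability.Probability"
begin

definition stochastic :: "real^'n^'n \<Rightarrow> bool" where
  "stochastic P \<longleftrightarrow> (\<forall>i j. 0 \<le> P $ i $ j) \<and> (\<forall>i. (\<Sum>j\<in>UNIV. P $ i $ j) = 1)"

text \<open>The product with the most recent factor on the left:
  \<open>left_prod A n\<close> is \<open>A n ** \<dots> ** A 1\<close>; the value \<open>A 0\<close> is never used.\<close>

primrec left_prod :: "(nat \<Rightarrow> real^'n^'n) \<Rightarrow> nat \<Rightarrow> real^'n^'n" where
  "left_prod A 0 = mat 1"
| "left_prod A (Suc n) = A (Suc n) ** left_prod A n"

text \<open>A matrix of order one has no pair of distinct rows. Its ergodic coefficient is set to \<open>1\<close>,
  the greatest value the coefficient of a stochastic matrix can take.\<close>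

definition ergodic_coeff :: "real^'n^'n \<Rightarrow> real" where
  "ergodic_coeff P =
     (if CARD('n) = 1 then 1
      else Min {(\<Sum>j\<in>UNIV. min (P $ i1 $ j) (P $ i2 $ j)) | i1 i2. i1 \<noteq> i2})"

definition ergodic_lambda :: "real^'n^'n \<Rightarrow> real" where
  "ergodic_lambda P = 1 - ergodic_coeff P"

definition scrambling :: "real^'n^'n \<Rightarrow> bool" where
  "scrambling P \<longleftrightarrow> ergodic_lambda P < 1"

end

theory Submission
  imports Defs
begin

text \<open>
  Left multiplication by a stochastic matrix replaces the entries of a column by averages of
  them, so in every column the maximum decreases and the minimum increases along the product.
  A scrambling factor shrinks their difference by a constant factor less than one. If some word
  is scrambling, almost every sequence contains it in infinitely many disjoint blocks, by the
  Borel zero-one law, and the columns converge to constant vectors. Conversely, a stochastic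
  limit of rank one has equal rows and thus a positive column, and a stochastic matrix with a
  positive column is scrambling.
\<close>

section \<open>Stochastic and scrambling matrices\<close>

lemma stochastic_mat_1: "stochastic (mat 1 :: real^'n^'n)"
  by (auto simp: stochastic_def mat_def)

lemma stochastic_mult:
  fixes P Q :: "real^'n^'n"
  assumes "stochastic P" "stochastic Q"
  shows "stochastic (P ** Q)"
proof -
  have "(\<Sum>j\<in>UNIV. \<Sum>k\<in>UNIV. P $ i $ k * Q $ k $ j) = 1" for i
    using assms by (subst sum.swap) (simp add: stochastic_def flip: sum_distrib_left)
  then show ?thesis
    using assms by (auto simp: stochastic_def matrix_matrix_mult_def intro!: sum_nonneg)
qed

lemma stochastic_left_prod:
  assumes "\<And>t. t \<ge> 1 \<Longrightarrow> t \<le> n \<Longrightarrow> stochastic (Y t)"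
  shows "stochastic (left_prod Y n)"
  using assms by (induction n) (auto intro: stochastic_mult stochastic_mat_1)

text \<open>Splits off the window of factors after time \<open>n\<close>, so that a word occurring
  in mid-sequence can be seen to act on the columns built up so far.\<close>

lemma left_prod_add: "left_prod Y (n + m) = left_prod (\<lambda>t. Y (n + t)) m ** left_prod Y n"
  by (induction m) (auto simp: matrix_mul_assoc)

lemma left_prod_cong:
  assumes "\<And>t. t \<in> {1..n} \<Longrightarrow> Y t = Z t"
  shows "left_prod Y n = left_prod Z n"
  using assms by (induction n) auto

lemma stochastic_limit:
  fixes P :: "nat \<Rightarrow> real^'n^'n"
  assumes "\<And>n. stochastic (P n)" "P \<longlonglongrightarrow> L"
  shows "stochastic L"
proof -
  have ij: "(\<lambda>n. P n $ i $ j) \<longlonglongrightarrow> L $ i $ j" for i j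
    using assms(2) by (intro tendsto_vec_nth)
  have "0 \<le> L $ i $ j" for i j
    using ij assms(1) by (intro LIMSEQ_le_const[of "\<lambda>n. P n $ i $ j"]) (auto simp: stochastic_def)
  moreover have "(\<Sum>j\<in>UNIV. L $ i $ j) = 1" for i
  proof -
    have "(\<lambda>n. \<Sum>j\<in>UNIV. P n $ i $ j) \<longlonglongrightarrow> (\<Sum>j\<in>UNIV. L $ i $ j)"
      using ij by (intro tendsto_sum)
    then show ?thesis
      using assms(1) by (simp add: stochastic_def LIMSEQ_const_iff)
  qed
  ultimately show ?thesis by (simp add: stochastic_def)
qed

lemma finite_ergodic_set:
  fixes P :: "real^'n^'n"
  shows "finite {(\<Sum>j\<in>UNIV. min (P $ i1 $ j) (P $ i2 $ j)) | i1 i2. i1 \<noteq> i2}"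
proof -
  have "{(\<Sum>j\<in>UNIV. min (P $ i1 $ j) (P $ i2 $ j)) | i1 i2. i1 \<noteq> i2} \<subseteq>
      range (\<lambda>(i1, i2). \<Sum>j\<in>UNIV. min (P $ i1 $ j) (P $ i2 $ j))"
    by auto
  then show ?thesis by (rule finite_subset) auto
qed

lemma ex_distinct_if_CARD_ne_1:
  assumes "CARD('n::finite) \<noteq> 1"
  shows "\<exists>i1 i2 :: 'n. i1 \<noteq> i2"
proof (rule ccontr)
  assume "\<not> ?thesis"
  then have "(UNIV :: 'n set) = {undefined}" by auto
  then show False using assms by (metis card.empty card_insert_disjoint empty_iff finite.emptyI One_nat_def)
qed

lemma ergodic_coeff_le:
  fixes P :: "real^'n^'n"
  assumes "i1 \<noteq> i2"
  shows "ergodic_coeff P \<le> (\<Sum>j\<in>UNIV. min (P $ i1 $ j) (P $ i2 $ j))"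
proof -
  have "CARD('n) \<noteq> 1" using assms by (metis UNIV_I card_1_singletonE singletonD)
  then show ?thesis
    using finite_ergodic_set[of P] assms unfolding ergodic_coeff_def by (auto intro!: Min_le)
qed

text \<open>The overlap of two rows is at most a row sum, hence at most 1; in order one the
  convention gives \<open>ergodic_lambda P = 0\<close>.\<close>

lemma ergodic_lambda_nonneg:
  fixes P :: "real^'n^'n"
  assumes "stochastic P"
  shows "0 \<le> ergodic_lambda P"
proof (cases "CARD('n) = 1")
  case True
  then show ?thesis by (simp add: ergodic_lambda_def ergodic_coeff_def)
next
  case False
  then obtain i1 i2 :: 'n where "i1 \<noteq> i2" using ex_distinct_if_CARD_ne_1 by blast
  then have "ergodic_coeff P \<le> (\<Sum>j\<in>UNIV. min (P $ i1 $ j) (P $ i2 $ j))"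
    by (rule ergodic_coeff_le)
  also have "\<dots> \<le> (\<Sum>j\<in>UNIV. P $ i1 $ j)" by (intro sum_mono) auto
  also have "\<dots> = 1" using assms by (simp add: stochastic_def)
  finally show ?thesis by (simp add: ergodic_lambda_def)
qed

text \<open>Column \<open>j\<close> alone makes the overlap of any two rows positive, and a minimum
  over finitely many pairs stays positive.\<close>

lemma scrambling_if_positive_column:
  fixes P :: "real^'n^'n"
  assumes "stochastic P" "\<And>i. 0 < P $ i $ j"
  shows "scrambling P"
proof (cases "CARD('n) = 1")
  case True
  then show ?thesis by (simp add: scrambling_def ergodic_lambda_def ergodic_coeff_def)
next
  case False
  have "0 < (\<Sum>k\<in>UNIV. min (P $ i1 $ k) (P $ i2 $ k))" for i1 i2
    using assms by (intro sum_pos2[of _ j]) (auto simp: stochastic_def)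
  moreover have "{(\<Sum>j\<in>UNIV. min (P $ i1 $ j) (P $ i2 $ j)) | i1 i2. i1 \<noteq> i2} \<noteq> {}"
    using ex_distinct_if_CARD_ne_1[OF False] by auto
  ultimately have "0 < ergodic_coeff P"
    using finite_ergodic_set[of P] False by (auto simp: ergodic_coeff_def)
  then show ?thesis by (simp add: scrambling_def ergodic_lambda_def)
qed

section \<open>Oscillation of a vector\<close>

definition vec_max :: "real^'n \<Rightarrow> real" where
  "vec_max v = Max (range (($) v))"

definition vec_min :: "real^'n \<Rightarrow> real" where
  "vec_min v = Min (range (($) v))"

text \<open>A seminorm that vanishes exactly on constant vectors: it measures how far a column is
  from having equal entries.\<close>

definition osc :: "real^'n \<Rightarrow> real" where
  "osc v = vec_max v - vec_min v"

lemma vec_max_ge: "v $ i \<le> vec_max v"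
  and vec_min_le: "vec_min v \<le> v $ i"
  by (auto simp: vec_max_def vec_min_def)

lemma vec_max_least: "(\<And>i. v $ i \<le> b) \<Longrightarrow> vec_max v \<le> b"
  and vec_min_greatest: "(\<And>i. b \<le> v $ i) \<Longrightarrow> b \<le> vec_min v"
  by (auto simp: vec_max_def vec_min_def)

lemma osc_nonneg: "0 \<le> osc v"
  using vec_max_ge[of v] vec_min_le[of v] by (auto simp: osc_def intro: order_trans)

lemma osc_le:
  assumes "\<And>i k. v $ i - v $ k \<le> b"
  shows "osc v \<le> b"
proof -
  have "vec_max v \<in> range (($) v)" "vec_min v \<in> range (($) v)"
    unfolding vec_max_def vec_min_def by (intro Max_in Min_in; auto)+
  then show ?thesis using assms by (auto simp: osc_def)
qed

lemma stochastic_vec_max_le: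
  assumes "stochastic P"
  shows "vec_max (P *v v) \<le> vec_max v"
proof (rule vec_max_least)
  fix i
  have "(P *v v) $ i \<le> (\<Sum>j\<in>UNIV. P $ i $ j * vec_max v)"
    unfolding matrix_vector_mult_def using assms
    by (auto simp: stochastic_def intro!: sum_mono mult_left_mono vec_max_ge)
  then show "(P *v v) $ i \<le> vec_max v"
    using assms by (simp add: stochastic_def flip: sum_distrib_right)
qed

lemma stochastic_vec_min_ge:
  assumes "stochastic P"
  shows "vec_min v \<le> vec_min (P *v v)"
proof (rule vec_min_greatest)
  fix i
  have "(\<Sum>j\<in>UNIV. P $ i $ j * vec_min v) \<le> (P *v v) $ i"
    unfolding matrix_vector_mult_def using assms
    by (auto simp: stochastic_def intro!: sum_mono mult_left_mono vec_min_le)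
  then show "vec_min v \<le> (P *v v) $ i"
    using assms by (simp add: stochastic_def flip: sum_distrib_right)
qed

text \<open>The common part \<open>min (P $ i $ j) (P $ k $ j)\<close> of two rows cancels in the difference of the
  two averages; what remains of either row has total mass at most \<open>ergodic_lambda P\<close>.\<close>

lemma osc_mult_le:
  fixes P :: "real^'n^'n"
  assumes P: "stochastic P"
  shows "osc (P *v v) \<le> ergodic_lambda P * osc v"
proof (rule osc_le)
  fix i k
  show "(P *v v) $ i - (P *v v) $ k \<le> ergodic_lambda P * osc v"
  \<comment> \<open>The ergodic coefficient bounds the overlap of distinct rows only; for equal rows
    the left side is zero.\<close>
  proof (cases "i = k")
    case True
    then show ?thesis using ergodic_lambda_nonneg[OF P] osc_nonneg[of v] by simp
  next
    case False
    define m where "m j = min (P $ i $ j) (P $ k $ j)" for j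
    have rest: "(\<Sum>j\<in>UNIV. P $ r $ j - m j) = 1 - sum m UNIV" for r
      using P by (simp add: sum_subtractf stochastic_def)
    have "(P *v v) $ i - (P *v v) $ k =
        (\<Sum>j\<in>UNIV. (P $ i $ j - m j) * v $ j) - (\<Sum>j\<in>UNIV. (P $ k $ j - m j) * v $ j)"
      by (simp add: matrix_vector_mult_def algebra_simps flip: sum_subtractf)
    \<comment> \<open>The remaining weights are nonnegative because \<open>m\<close> lies below both
      rows.\<close>
    also have "\<dots> \<le> (\<Sum>j\<in>UNIV. (P $ i $ j - m j) * vec_max v)
        - (\<Sum>j\<in>UNIV. (P $ k $ j - m j) * vec_min v)"
      by (intro diff_mono sum_mono mult_left_mono vec_max_ge vec_min_le) (auto simp: m_def)
    also have "\<dots> = (1 - sum m UNIV) * osc v"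
      by (simp only: flip: sum_distrib_right) (simp add: rest osc_def algebra_simps)
    also have "\<dots> \<le> ergodic_lambda P * osc v"
      using ergodic_coeff_le[OF False, of P] osc_nonneg[of v]
      by (intro mult_right_mono) (auto simp: ergodic_lambda_def m_def)
    finally show ?thesis .
  qed
qed

section \<open>Limits of rank one\<close>

lemma rank_eq_1_if_rows_eq:
  fixes L :: "real^'n^'n"
  assumes "c \<noteq> 0" "\<And>i. L $ i = c"
  shows "rank L = 1"
proof -
  have "rows L = {c}"
    using assms(2) by (auto simp: rows_def row_def vec_lambda_eta)
  then show ?thesis using assms(1) by (simp add: row_rank_def)
qed

text \<open>In rank one all rows are multiples of a single vector, and the common row sum 1 forces
  equal multipliers.\<close>

lemma stochastic_rank_1_rows_eq:
  fixes L :: "real^'n^'n"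
  assumes "stochastic L" "rank L = 1"
  shows "L $ i = L $ k"
proof -
  obtain S where S: "S \<subseteq> rows L" "rows L \<subseteq> span S" "card S = dim (rows L)"
    using basis_exists[of "rows L"] by metis
  then obtain u where "S = {u}"
    using assms(2) by (metis row_rank_def card_1_singletonE)
  moreover have "L $ r \<in> rows L" for r
    by (auto simp: rows_def row_def vec_lambda_eta)
  ultimately have "\<exists>a. L $ r = a *\<^sub>R u" for r
    using S(2) by (force simp: span_singleton)
  then obtain a where a: "\<And>r. L $ r = a r *\<^sub>R u" by metis
  have "a r * (\<Sum>j\<in>UNIV. u $ j) = 1" for r
    using assms(1) by (simp add: stochastic_def a flip: sum_distrib_left)
  then have "a i = a k" by (metis mult_cancel_right zero_neq_one mult_zero_right)
  then show ?thesis by (simp add: a)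
qed

text \<open>The limit has equal rows with sum 1, so one of its columns is positive throughout. The
  finitely many entries of that column are positive in \<open>P n\<close> from some \<open>n\<close>
  on.\<close>

lemma eventually_scrambling:
  fixes P :: "nat \<Rightarrow> real^'n^'n"
  assumes P: "\<And>n. stochastic (P n)" and lim: "P \<longlonglongrightarrow> L" and rank: "rank L = 1"
  shows "\<forall>\<^sub>F n in sequentially. scrambling (P n)"
proof -
  have L: "stochastic L" using stochastic_limit[OF P lim] .
  \<comment> \<open>Here \<open>undefined\<close> serves as an arbitrary row index; the rows of
    \<open>L\<close> agree.\<close>
  have "\<exists>j. 0 < L $ undefined $ j"
  proof (rule ccontr)
    assume "\<not> ?thesis"
    then have "(\<Sum>j\<in>UNIV. L $ undefined $ j) \<le> 0" by (auto intro!: sum_nonpos simp: not_less)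
    then show False using L by (simp add: stochastic_def)
  qed
  then obtain j where "0 < L $ undefined $ j" by blast
  then have "0 < L $ i $ j" for i using stochastic_rank_1_rows_eq[OF L rank] by metis
  then have "\<forall>\<^sub>F n in sequentially. 0 < P n $ i $ j" for i
    using lim by (intro order_tendstoD(1)[of _ "L $ i $ j"] tendsto_vec_nth)
  then have "\<forall>\<^sub>F n in sequentially. \<forall>i. 0 < P n $ i $ j"
    by (rule eventually_all_finite)
  then show ?thesis
    by eventually_elim (use P scrambling_if_positive_column in blast)
qed

text \<open>The oscillation of each column converges by monotonicity. Windows equal to
  \<open>Q\<close> at arbitrarily late times force its limit \<open>d\<close> to satisfy
  \<open>d \<le> ergodic_lambda Q * d\<close>, so \<open>d = 0\<close>; neither a rate nor
  disjointness of the windows enters.\<close>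

lemma left_prod_convergent_rank_1:
  fixes Y :: "nat \<Rightarrow> real^'n^'n"
  assumes Y: "\<And>t. t \<ge> 1 \<Longrightarrow> stochastic (Y t)"
    and scr: "scrambling Q"
    and freq: "\<exists>\<^sub>F n in sequentially. left_prod (\<lambda>t. Y (n + t)) N = Q"
  shows "\<exists>L. rank L = 1 \<and> left_prod Y \<longlonglongrightarrow> L"
proof -
  have Q: "stochastic Q"
    using frequently_ex[OF freq] stochastic_left_prod[of N] Y by (metis trans_le_add2)
  have "\<exists>c. \<forall>i. (\<lambda>n. left_prod Y n $ i $ j) \<longlonglongrightarrow> c" for j
  proof -
    define v where "v n = column j (left_prod Y n)" for n
    have v_nth: "v n $ i = left_prod Y n $ i $ j" for n i by (simp add: v_def column_def)
    have v_add: "v (n + m) = left_prod (\<lambda>t. Y (n + t)) m *v v n" for n m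
      by (simp add: vec_eq_iff v_nth left_prod_add matrix_matrix_mult_def matrix_vector_mult_def)
    have v_Suc: "v (Suc n) = Y (Suc n) *v v n" for n
      using v_add[of n 1] by simp
    have dec: "decseq (\<lambda>n. vec_max (v n))"
      by (auto intro!: decseq_SucI simp: v_Suc stochastic_vec_max_le Y)
    have inc: "incseq (\<lambda>n. vec_min (v n))"
      by (auto intro!: incseq_SucI simp: v_Suc stochastic_vec_min_ge Y)
    \<comment> \<open>Each maximum dominates the minimum at the same time, hence the initial
      minimum; dually for the minima.\<close>
    have bounds: "\<forall>n. vec_min (v 0) \<le> vec_max (v n)" "\<forall>n. vec_min (v n) \<le> vec_max (v 0)"
      using osc_nonneg[of "v _"] decseqD[OF dec, of 0] incseqD[OF inc, of 0]
      by (auto simp: osc_def intro: order_trans)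
    obtain a where a: "(\<lambda>n. vec_max (v n)) \<longlonglongrightarrow> a"
      using decseq_convergent[OF dec bounds(1)] by blast
    obtain b where b: "(\<lambda>n. vec_min (v n)) \<longlonglongrightarrow> b"
      using incseq_convergent[OF inc bounds(2)] by blast
    have osc: "(\<lambda>n. osc (v n)) \<longlonglongrightarrow> a - b"
      unfolding osc_def by (intro tendsto_diff a b)
    have "a = b"
    proof (rule ccontr)
      assume "a \<noteq> b"
      moreover have "0 \<le> a - b"
        using osc by (rule LIMSEQ_le_const) (use osc_nonneg in auto)
      ultimately have pos: "0 < (a - b) - ergodic_lambda Q * (a - b)"
        using scr by (simp add: scrambling_def)
      \<comment> \<open>A shift by \<open>N\<close> keeps the limit of the oscillations. A positive
        limit of this difference contradicts contraction at every late window equal to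
        \<open>Q\<close>.\<close>
      have "(\<lambda>n. osc (v (n + N)) - ergodic_lambda Q * osc (v n)) \<longlonglongrightarrow>
          (a - b) - ergodic_lambda Q * (a - b)"
        by (intro tendsto_intros osc LIMSEQ_ignore_initial_segment[OF osc])
      from order_tendstoD(1)[OF this pos]
      have "\<forall>\<^sub>F n in sequentially. left_prod (\<lambda>t. Y (n + t)) N \<noteq> Q"
      proof eventually_elim
        case (elim n)
        then have "osc (v (n + N)) \<noteq> osc (Q *v v n)"
          using osc_mult_le[OF Q, of "v n"] by linarith
        then show ?case by (auto simp: v_add)
      qed
      then show False using freq by (simp add: frequently_def)
    qed
    have "(\<lambda>n. v n $ i) \<longlonglongrightarrow> a" for i
    proof (rule tendsto_sandwich)
      show "(\<lambda>n. vec_min (v n)) \<longlonglongrightarrow> a" using b \<open>a = b\<close> by simp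
      show "(\<lambda>n. vec_max (v n)) \<longlonglongrightarrow> a" by (fact a)
    qed (simp_all add: vec_min_le vec_max_ge)
    then show ?thesis by (auto simp: v_nth)
  qed
  then obtain c where c: "\<And>i j. (\<lambda>n. left_prod Y n $ i $ j) \<longlonglongrightarrow> c j" by metis
  define L :: "real^'n^'n" where "L = (\<chi> i. \<chi> j. c j)"
  have lim: "left_prod Y \<longlonglongrightarrow> L"
    by (auto simp: L_def c intro!: vec_tendstoI)
  \<comment> \<open>The row sums 1 rule out the zero matrix, whose rows are also equal but whose
    rank is 0.\<close>
  have "stochastic L"
    using lim by (rule stochastic_limit[rotated]) (auto intro: stochastic_left_prod Y)
  then have "sum c UNIV = 1" by (simp add: stochastic_def L_def)
  then have "(\<chi> j. c j) \<noteq> 0"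
    by (metis vec_lambda_beta zero_index sum.neutral zero_neq_one)
  then have "rank L = 1" by (rule rank_eq_1_if_rows_eq) (simp add: L_def)
  with lim show ?thesis by blast
qed

section \<open>Recurrence of words in an independent sequence\<close>

text \<open>By the zero-one law it suffices to exclude that almost surely only finitely many events
  occur. The limit superior of the events has probability at least \<open>p\<close> by continuity
  from above.\<close>

lemma (in prob_space) AE_infinitely_often:
  fixes E :: "nat \<Rightarrow> 'a \<Rightarrow> bool"
  assumes indep: "indep_events (\<lambda>k. {x\<in>space M. E k x}) UNIV"
    and p: "0 < p" "\<And>k. p \<le> prob {x\<in>space M. E k x}"
  shows "AE x in M. \<exists>\<^sub>\<infinity>k. E k x"
proof -
  have meas[measurable]: "\<And>k. {x\<in>space M. E k x} \<in> events"
    using indep by (auto simp: indep_events_def)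
  \<comment> \<open>\<open>U n\<close> says that some event with index at least \<open>n\<close>
    occurs; the intersection of all \<open>U n\<close> is the limit superior.\<close>
  define U where "U n = (\<Union>k\<in>{n..}. {x\<in>space M. E k x})" for n
  have U: "U n \<in> events" for n by (auto simp: U_def)
  have "(\<lambda>n. prob (U n)) \<longlonglongrightarrow> prob (\<Inter>n. U n)"
    using U by (intro finite_Lim_measure_decseq) (auto simp: decseq_def U_def intro: order_trans)
  moreover have "p \<le> prob (U n)" for n
    by (rule order_trans[OF p(2)[of n]], rule finite_measure_mono) (use U in \<open>auto simp: U_def\<close>)
  ultimately have "p \<le> prob (\<Inter>n. U n)" by (intro LIMSEQ_le_const) auto
  then have "prob (\<Inter>n. U n) \<noteq> 0" using p(1) by simp
  moreover have "prob (\<Inter>n. U n) = 0" if "AE x in M. finite {k. E k x}"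
  proof -
    have "(\<Inter>n. U n) \<in> events" using U by auto
    then show ?thesis using that
      by (simp add: prob_eq_0)
        (auto simp: U_def Bex_def Ball_def finite_nat_iff_bounded not_less[symmetric])
  qed
  ultimately show ?thesis
    using borel_0_1_law_AE[OF indep] unfolding frequently_cofinite by blast
qed

text \<open>Cutting time into disjoint blocks of length \<open>N\<close> makes the occurrences of
  the word independent, each with the same positive probability
  \<open>\<Prod>i=1..N. q i\<close>.\<close>

lemma (in prob_space) AE_block_infinitely_often:
  fixes X :: "nat \<Rightarrow> 'a \<Rightarrow> 'b::t1_space"
  assumes indep: "indep_vars (\<lambda>_. borel) X {1..}"
    and pos: "\<And>i. i \<in> {1..N} \<Longrightarrow> 0 < q i"
    and prob: "\<And>t i. t \<ge> 1 \<Longrightarrow> i \<in> {1..N} \<Longrightarrow> prob {x\<in>space M. X t x = B i} = q i"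
    and N: "N \<ge> 1"
  shows "AE x in M. \<exists>\<^sub>\<infinity>k. \<forall>i\<in>{1..N}. X (k * N + i) x = B i"
proof (rule AE_infinitely_often)
  define K where "K k = (\<lambda>i. k * N + i) ` {1..N}" for k
  have K_disj: "disjoint_family K"
  proof -
    \<comment> \<open>Times start at 1, so the block number is recovered from
      \<open>t - 1\<close>.\<close>
    have "(t - 1) div N = k" if "t \<in> K k" for t k
    proof -
      obtain i where "t = k * N + i" "i \<in> {1..N}" using \<open>t \<in> K k\<close> unfolding K_def by blast
      then have "t - 1 = (i - 1) + k * N" "i - 1 < N" by auto
      then show ?thesis using N by simp
    qed
    then show ?thesis unfolding disjoint_family_on_def by blast
  qed
  have "indep_vars (\<lambda>k. PiM (K k) (\<lambda>_. borel)) (\<lambda>k x. restrict (\<lambda>i. X i x) (K k)) UNIV"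
    by (rule indep_vars_restrict[OF indep _ K_disj]) (auto simp: K_def)
  then have "indep_events (\<lambda>k. {x\<in>space M. \<forall>i\<in>{1..N}. restrict (\<lambda>i. X i x) (K k) (k * N + i) = B i}) UNIV"
  proof (rule indep_eventsI_indep_vars)
    fix k
    have "{f \<in> space (Pi\<^sub>M (K k) (\<lambda>_. borel)). f (k * N + i) = B i} \<in> sets (Pi\<^sub>M (K k) (\<lambda>_. borel))"
      if "i \<in> {1..N}" for i
    proof -
      have "(\<lambda>f. f (k * N + i)) \<in> measurable (Pi\<^sub>M (K k) (\<lambda>_. borel)) borel"
        using that by (intro measurable_component_singleton) (auto simp: K_def)
      \<comment> \<open>Singletons are closed in a T1 space, hence Borel.\<close>
      from measurable_sets[OF this, of "{B i}"] show ?thesis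
        by (simp add: vimage_def Int_def conj_commute)
    qed
    then show "{f \<in> space (Pi\<^sub>M (K k) (\<lambda>_. borel)). \<forall>i\<in>{1..N}. f (k * N + i) = B i}
        \<in> sets (Pi\<^sub>M (K k) (\<lambda>_. borel))"
      using N by (intro sets.sets_Collect_finite_All') auto
  qed
  then show "indep_events (\<lambda>k. {x\<in>space M. \<forall>i\<in>{1..N}. X (k * N + i) x = B i}) UNIV"
    by (simp add: K_def cong: conj_cong)
  show "0 < (\<Prod>i=1..N. q i)"
    using pos by (intro prod_pos) auto
  fix k
  \<comment> \<open>For \<open>t\<close> in block \<open>k\<close>, the position inside the word is
    \<open>t - k * N\<close>.\<close>
  have "prob (\<Inter>t\<in>K k. X t -` {B (t - k * N)} \<inter> space M) =
      (\<Prod>t\<in>K k. prob (X t -` {B (t - k * N)} \<inter> space M))"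
    using N by (intro indep_varsD[OF indep]) (auto simp: K_def)
  also have "\<dots> = (\<Prod>i=1..N. prob (X (k * N + i) -` {B i} \<inter> space M))"
    unfolding K_def by (subst prod.reindex) (auto simp: inj_on_def)
  also have "\<dots> = (\<Prod>i=1..N. q i)"
    using N by (intro prod.cong refl) (auto simp: vimage_def Int_def conj_commute intro!: prob)
  also have "(\<Inter>t\<in>K k. X t -` {B (t - k * N)} \<inter> space M) =
      {x\<in>space M. \<forall>i\<in>{1..N}. X (k * N + i) x = B i}"
    unfolding K_def image_image using N by auto
  finally show "(\<Prod>i=1..N. q i) \<le> prob {x\<in>space M. \<forall>i\<in>{1..N}. X (k * N + i) x = B i}"
    by simp
qed

section \<open>Equivalence of almost sure rank one convergence and the existence of a scrambling
  word\<close>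

theorem proposition19:
  fixes A :: "nat \<Rightarrow> real^'n^'n"
    and w :: "nat \<Rightarrow> real"
    and l :: nat
    and M :: "'a measure"
    and X :: "nat \<Rightarrow> 'a \<Rightarrow> real^'n^'n"
  assumes "inj_on A {1..l}"
    and "\<And>i. i \<in> {1..l} \<Longrightarrow> stochastic (A i)"
    and "\<And>i. i \<in> {1..l} \<Longrightarrow> w i > 0"
    and "(\<Sum>i=1..l. w i) = 1"
    and "prob_space M"
    and "prob_space.indep_vars M (\<lambda>_. borel) X {1..}"
    and "\<And>t i. t \<ge> 1 \<Longrightarrow> i \<in> {1..l} \<Longrightarrow>
           measure M {\<omega> \<in> space M. X t \<omega> = A i} = w i"
  shows "(AE \<omega> in M. \<exists>L. rank L = 1 \<and> (\<lambda>n. left_prod (\<lambda>t. X t \<omega>) n) \<longlonglongrightarrow> L)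
    \<longleftrightarrow> (\<exists>N B. N \<ge> 1 \<and> (\<forall>i\<in>{1..N}. B i \<in> A ` {1..l}) \<and> scrambling (left_prod B N))"
proof -
  interpret prob_space M by fact
  have rv: "X t \<in> borel_measurable M" if "t \<ge> 1" for t
    using assms(6) that by (auto simp: indep_vars_def)
  have level: "{\<omega> \<in> space M. X t \<omega> = C} \<in> events" if "t \<ge> 1" for t C
    using measurable_sets[OF rv[OF that], of "{C}"] by (simp add: vimage_def Int_def conj_commute)
  have "AE \<omega> in M. X t \<omega> \<in> A ` {1..l}" if t: "t \<ge> 1" for t
  proof -
    \<comment> \<open>Injectivity of \<open>A\<close> makes these events disjoint, so their
      probabilities add up to the total weight 1.\<close>
    have "prob (\<Union>i\<in>{1..l}. {\<omega> \<in> space M. X t \<omega> = A i}) =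
        (\<Sum>i=1..l. prob {\<omega> \<in> space M. X t \<omega> = A i})"
    proof (rule finite_measure_finite_Union)
      show "disjoint_family_on (\<lambda>i. {\<omega> \<in> space M. X t \<omega> = A i}) {1..l}"
        unfolding disjoint_family_on_def using inj_onD[OF assms(1)] by fastforce
    qed (use level[OF t] in blast)+
    also have "\<dots> = 1" using assms(4,7) t by simp
    finally have "AE \<omega> in M. \<omega> \<in> (\<Union>i\<in>{1..l}. {\<omega> \<in> space M. X t \<omega> = A i})"
      using level[OF t] by (subst (asm) prob_eq_1) auto
    then show ?thesis by eventually_elim auto
  qed
  then have "AE \<omega> in M. \<forall>t\<in>{1..}. X t \<omega> \<in> A ` {1..l}"
    by (subst AE_ball_countable) auto
  then have in_S: "AE \<omega> in M. \<forall>t\<ge>1. X t \<omega> \<in> A ` {1..l}" by (simp add: Ball_def)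
  show ?thesis
  proof
    assume "AE \<omega> in M. \<exists>L. rank L = 1 \<and> (\<lambda>n. left_prod (\<lambda>t. X t \<omega>) n) \<longlonglongrightarrow> L"
    with in_S have "AE \<omega> in M. (\<forall>t\<ge>1. X t \<omega> \<in> A ` {1..l}) \<and>
        (\<exists>L. rank L = 1 \<and> (\<lambda>n. left_prod (\<lambda>t. X t \<omega>) n) \<longlonglongrightarrow> L)"
      by (rule AE_conjI)
    \<comment> \<open>An almost sure property holds at some outcome; a single convergent path
      already yields the word.\<close>
    from eventually_happens'[OF ae_filter_bot this] obtain \<omega> L
      where vals: "\<And>t. t \<ge> 1 \<Longrightarrow> X t \<omega> \<in> A ` {1..l}"
      and L: "rank L = 1" "(\<lambda>n. left_prod (\<lambda>t. X t \<omega>) n) \<longlonglongrightarrow> L"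
      by blast
    have "stochastic (left_prod (\<lambda>t. X t \<omega>) n)" for n
      using vals assms(2) by (intro stochastic_left_prod) force
    from eventually_scrambling[OF this L(2,1)] eventually_ge_at_top[of 1]
    have "\<forall>\<^sub>F n in sequentially. n \<ge> 1 \<and> scrambling (left_prod (\<lambda>t. X t \<omega>) n)"
      by eventually_elim auto
    from eventually_happens'[OF sequentially_bot this]
    obtain N where "N \<ge> 1" "scrambling (left_prod (\<lambda>t. X t \<omega>) N)"
      by blast
    then show "\<exists>N B. N \<ge> 1 \<and> (\<forall>i\<in>{1..N}. B i \<in> A ` {1..l}) \<and> scrambling (left_prod B N)"
      using vals by (intro exI[of _ N] exI[of _ "\<lambda>t. X t \<omega>"]) auto
  next
    assume "\<exists>N B. N \<ge> 1 \<and> (\<forall>i\<in>{1..N}. B i \<in> A ` {1..l}) \<and> scrambling (left_prod B N)"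
    then obtain N B where N: "N \<ge> 1" and B: "\<forall>i\<in>{1..N}. B i \<in> A ` {1..l}"
      and scr: "scrambling (left_prod B N)" by blast
    \<comment> \<open>The index \<open>s i\<close> of the letter \<open>B i\<close> gives its
      probability \<open>w (s i)\<close>.\<close>
    from B have "\<forall>i\<in>{1..N}. \<exists>k. k \<in> {1..l} \<and> B i = A k" by blast
    from bchoice[OF this] obtain s
      where s: "\<And>i. i \<in> {1..N} \<Longrightarrow> s i \<in> {1..l} \<and> B i = A (s i)" by blast
    have "AE \<omega> in M. \<exists>\<^sub>\<infinity>k. \<forall>i\<in>{1..N}. X (k * N + i) \<omega> = B i"
    proof (rule AE_block_infinitely_often[OF assms(6)])
      show "0 < w (s i)" if "i \<in> {1..N}" for i
        using s[OF that] assms(3) by blast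
      show "prob {\<omega> \<in> space M. X t \<omega> = B i} = w (s i)" if "t \<ge> 1" "i \<in> {1..N}" for t i
        using s[OF that(2)] assms(7)[OF that(1)] by simp
    qed (fact N)
    with in_S show "AE \<omega> in M. \<exists>L. rank L = 1 \<and> (\<lambda>n. left_prod (\<lambda>t. X t \<omega>) n) \<longlonglongrightarrow> L"
    proof eventually_elim
      case (elim \<omega>)
      have "\<exists>\<^sub>F n in sequentially. left_prod (\<lambda>t. X (n + t) \<omega>) N = left_prod B N"
        unfolding frequently_sequentially
      proof
        fix m
        obtain k where k: "k \<ge> m" "\<forall>i\<in>{1..N}. X (k * N + i) \<omega> = B i"
          using elim(2) by (auto simp: INFM_nat_le)
        \<comment> \<open>Since \<open>N\<close> is at least 1, late blocks begin at late
          times.\<close>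
        then have "k * N \<ge> m" using N by (metis mult.right_neutral mult_le_mono)
        moreover have "left_prod (\<lambda>t. X (k * N + t) \<omega>) N = left_prod B N"
          using k(2) by (intro left_prod_cong) auto
        ultimately show "\<exists>n\<ge>m. left_prod (\<lambda>t. X (n + t) \<omega>) N = left_prod B N" by blast
      qed
      moreover have "stochastic (X t \<omega>)" if "t \<ge> 1" for t
        using elim(1) that assms(2) by force
      ultimately show ?case
        using left_prod_convergent_rank_1[of "\<lambda>t. X t \<omega>", OF _ scr] by blast
    qed
  qed
qed

end
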